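(* For all positive integers $\Delta$, \[ F_{2,\Delta}(n) \leq \left(\frac{n}{\Delta}\right)^{1/2} + O\left(n^{1/4}\right) \] as $n\rightarrow\infty$ (for fixed $\Delta$), and \[ \limsup_{n\rightarrow\infty} \frac{F_{2,\Delta}(n)}{(n/\Delta)^{1/2}} \leq 1. \]
   Context: For a set $A$ of integers, $2A=\{a+b: a,b\in A\}$. The set $A$ is a $B_2$-set (Sidon set) if, for all $a,b,c,d\in A$, $a+b=c+d$ if and only if $\{a,b\}=\{c,d\}$. A set $X$ of real numbers is $\Delta$-separated if $x'-x\geq\Delta$ for all $x,x'\in X$ with $x<x'$. A $B_{2,\Delta}$-set is a $B_2$-set $A$ whose sumset $2A$ is $\Delta$-separated; equivalently, if $a,b,c,d\in A$ and $\{a,b\}\neq\{c,d\}$, then $|(a+b)-(c+d)|\geq\Delta$. For a positive integer $n$, $F_{2,\Delta}(n)$ denotes the size of the largest $B_{2,\Delta}$-set contained in $\{1,2,\ldots,n\}$. *)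

theory Defs
  imports
    Complex_Main
    "HOL-Library.Set_Algebras"
    "HOL-Library.Extended_Real"
    "HOL-Library.Liminf_Limsup"
    "HOL-Library.Landau_Symbols"
begin

definition B2_set :: "int set \<Rightarrow> bool" where
  "B2_set A \<longleftrightarrow>
     (\<forall>a\<in>A. \<forall>b\<in>A. \<forall>c\<in>A. \<forall>d\<in>A. a + b = c + d \<longleftrightarrow> {a, b} = {c, d})"

definition separated :: "real \<Rightarrow> real set \<Rightarrow> bool" where
  "separated \<Delta> X \<longleftrightarrow> (\<forall>x\<in>X. \<forall>x'\<in>X. x < x' \<longrightarrow> x' - x \<ge> \<Delta>)"

(* A + A is the sumset 2A (pointwise addition of sets from Set_Algebras). *)
definition B2_sep_set :: "real \<Rightarrow> int set \<Rightarrow> bool" where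
  "B2_sep_set \<Delta> A \<longleftrightarrow> B2_set A \<and> separated \<Delta> (real_of_int ` (A + A))"

definition F2_sep :: "real \<Rightarrow> nat \<Rightarrow> nat" where
  "F2_sep \<Delta> n = Max (card ` {A. A \<subseteq> {1..int n} \<and> B2_sep_set \<Delta> A})"

(* The maximum in F2_sep is taken over a finite nonempty set. *)
lemma finite_B2_sep_sets: "finite {A. A \<subseteq> {1..int n} \<and> B2_sep_set \<Delta> A}"
  by (rule finite_subset[of _ "Pow {1..int n}"]) auto

lemma B2_sep_set_empty: "B2_sep_set \<Delta> {}"
  by (simp add: B2_sep_set_def B2_set_def separated_def set_plus_def)

lemma B2_sep_set_iff:
  assumes "\<Delta> > 0"
  shows "B2_sep_set \<Delta> A \<longleftrightarrow>
    (\<forall>a\<in>A. \<forall>b\<in>A. \<forall>c\<in>A. \<forall>d\<in>A. {a, b} \<noteq> {c, d} \<longrightarrow>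
       \<bar>real_of_int ((a + b) - (c + d))\<bar> \<ge> \<Delta>)" (is "?L \<longleftrightarrow> ?R")
proof
  assume L: ?L
  show ?R
  proof (intro ballI impI)
    fix a b c d assume m: "a \<in> A" "b \<in> A" "c \<in> A" "d \<in> A" and ne: "{a, b} \<noteq> {c, d}"
    have "a + b \<noteq> c + d"
      using L m ne unfolding B2_sep_set_def B2_set_def by blast
    moreover have "a + b \<in> A + A" "c + d \<in> A + A"
      using m by (auto intro: set_plus_intro)
    ultimately have
      "real_of_int (a + b) < real_of_int (c + d) \<longrightarrow>
         real_of_int (c + d) - real_of_int (a + b) \<ge> \<Delta>"
      "real_of_int (c + d) < real_of_int (a + b) \<longrightarrow>
         real_of_int (a + b) - real_of_int (c + d) \<ge> \<Delta>"
      "real_of_int (a + b) \<noteq> real_of_int (c + d)"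
      using L unfolding B2_sep_set_def separated_def of_int_eq_iff by blast+
    then show "\<bar>real_of_int ((a + b) - (c + d))\<bar> \<ge> \<Delta>"
      unfolding of_int_diff by linarith
  qed
next
  assume R: ?R
  have "a + b = c + d \<longleftrightarrow> {a, b} = {c, d}"
    if m: "a \<in> A" "b \<in> A" "c \<in> A" "d \<in> A" for a b c d
  proof
    assume "a + b = c + d"
    then have "\<not> \<bar>real_of_int ((a + b) - (c + d))\<bar> \<ge> \<Delta>" using assms by simp
    then show "{a, b} = {c, d}" using R m by blast
  qed (auto simp: doubleton_eq_iff)
  then have "B2_set A" unfolding B2_set_def by blast
  moreover have "separated \<Delta> (real_of_int ` (A + A))"
    unfolding separated_def
  proof (intro ballI impI)
    fix x x' assume "x \<in> real_of_int ` (A + A)" "x' \<in> real_of_int ` (A + A)" and lt: "x < x'"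
    then obtain a b c d where m: "a \<in> A" "b \<in> A" "c \<in> A" "d \<in> A"
      and x: "x = real_of_int (a + b)" "x' = real_of_int (c + d)"
      by (auto elim!: set_plus_elim)
    have "{c, d} \<noteq> {a, b}" using lt x by (auto simp: doubleton_eq_iff)
    then have "\<bar>real_of_int ((c + d) - (a + b))\<bar> \<ge> \<Delta>" using R m by blast
    then show "x' - x \<ge> \<Delta>" using lt x by simp
  qed
  ultimately show ?L by (simp add: B2_sep_set_def)
qed

end

theory Submission
  imports
    Defs
    "HOL-Analysis.Convex"
    "HOL-Real_Asymp.Real_Asymp"
begin

text \<open>
  The proof is the Erdos--Turan window argument. Let \<open>A \<subseteq> {1..n}\<close> be a \<open>B\<^sub>2,\<Delta>\<close>-set with \<open>k\<close> elements,
  and let \<open>A(m)\<close> be the number of elements of \<open>A\<close> in the window \<open>{m..<m+u}\<close>. The \<open>n+u-1\<close> windows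
  with \<open>2-u \<le> m \<le> n\<close> contain every element of \<open>A\<close> exactly \<open>u\<close> times, so the Cauchy--Schwarz
  inequality gives \<open>(k u)\<^sup>2 \<le> (n+u) * (\<Sum>m. A(m)\<^sup>2)\<close>. On the other hand, \<open>\<Sum>m. A(m)\<^sup>2\<close> counts the
  ordered pairs from \<open>A\<close> with the number of windows that contain both entries: the diagonal
  contributes \<open>k u\<close>, and a pair with difference \<open>d \<noteq> 0\<close> contributes \<open>u - \<bar>d\<bar>\<close> if \<open>\<bar>d\<bar> < u\<close>.

  The condition on \<open>A\<close> says that the differences of distinct ordered pairs of distinct elements lie
  at least \<open>\<Delta>\<close> apart. In particular \<open>d\<close> and \<open>-d\<close> do, so that the positive differences are at least
  \<open>\<Delta>/2\<close>. The open intervals of length \<open>\<Delta>\<close> centred at the positive differences are therefore disjoint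
  subsets of the positive half-line, and since \<open>x \<mapsto> max 0 (u-x)\<close> is convex, the midpoint rule bounds the
  sum of \<open>u - d\<close> over the positive differences \<open>d < u\<close> by \<open>u\<^sup>2/(2\<Delta>)\<close>
  (\<open>sum_separated_le\<close>). Altogether \<open>k\<^sup>2 \<le> (n+u) * (k/u + 1/\<Delta>)\<close> (\<open>card_B2_sep_set_window\<close>), that is,
  \<open>k\<^sup>2 \<le> s\<^sup>2 + k * t\<close> with \<open>s\<^sup>2 = (n+u)/\<Delta>\<close> and \<open>t = n/u + 1\<close>, so that \<open>k \<le> s + t\<close>. For fixed \<open>\<Delta>\<close>, the error
  terms \<open>s - sqrt (n/\<Delta>)\<close> and \<open>t\<close> are of order \<open>u / sqrt n\<close> and \<open>n/u\<close>, which balance at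
  \<open>u = \<lceil>n powr (3/4)\<rceil>\<close>; this choice gives \<open>k \<le> (n/\<Delta>) powr (1/2) + 3 * n powr (1/4)\<close>. The bound on
  the upper limit follows on division by \<open>(n/\<Delta>) powr (1/2)\<close>.
\<close>

section \<open>Differences in a separated Sidon set\<close>

text \<open>The bound is the midpoint rule for the convex function \<open>x \<mapsto> max 0 (u-x)\<close> on the disjoint
  open intervals of length \<open>\<Delta>\<close> that are centred at the points of \<open>D\<close> and lie to the right of \<open>l\<close>.\<close>

lemma sum_separated_le:
  fixes D :: "real set" and u l \<Delta> :: real
  assumes "finite D" "separated \<Delta> D" "\<Delta> > 0"
    and "\<And>d. d \<in> D \<Longrightarrow> l + \<Delta> / 2 \<le> d" and "\<And>d. d \<in> D \<Longrightarrow> d \<le> u"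
  shows "\<Delta> * (\<Sum>d\<in>D. u - d) \<le> (max 0 (u - l))\<^sup>2 / 2"
  using assms
proof (induction D arbitrary: l rule: finite_linorder_min_induct)
  case empty
  then show ?case by simp
next
  case (insert b D)
  have "b + \<Delta> \<le> d" if "d \<in> D" for d
  proof -
    have "b < d" using insert.hyps(2) that by blast
    then have "d - b \<ge> \<Delta>" using insert.prems(1) that by (auto simp: separated_def)
    then show ?thesis by simp
  qed
  \<comment> \<open>the interval around the least point \<open>b\<close> ends at \<open>b + \<Delta>/2\<close>, the new left bound for \<open>D\<close>\<close>
  then have "(b + \<Delta> / 2) + \<Delta> / 2 \<le> d" if "d \<in> D" for d
    using that[THEN \<open>\<And>d. d \<in> D \<Longrightarrow> b + \<Delta> \<le> d\<close>] by (simp add: add.assoc)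
  moreover have "separated \<Delta> D"
    using insert.prems(1) by (auto simp: separated_def)
  ultimately have IH: "\<Delta> * (\<Sum>d\<in>D. u - d) \<le> (max 0 (u - (b + \<Delta> / 2)))\<^sup>2 / 2"
    using insert.prems by (intro insert.IH) auto
  have "b \<le> u" and lb: "l + \<Delta> / 2 \<le> b" using insert.prems by auto
  have "b \<notin> D" using insert.hyps(2) by blast
  then have "\<Delta> * (\<Sum>d\<in>insert b D. u - d) = \<Delta> * (u - b) + \<Delta> * (\<Sum>d\<in>D. u - d)"
    using insert.hyps(1) by (simp add: distrib_left)
  also have "\<dots> \<le> \<Delta> * (u - b) + (max 0 (u - (b + \<Delta> / 2)))\<^sup>2 / 2"
    using IH by simp
  also have "\<dots> \<le> (u - b + \<Delta> / 2)\<^sup>2 / 2"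
  proof (cases "u - b \<le> \<Delta> / 2")
    case True
    have "0 \<le> (u - b - \<Delta> / 2)\<^sup>2" by simp
    then show ?thesis using True by (simp add: power2_eq_square algebra_simps)
  next
    case False
    have "\<Delta> * (u - b) + (u - (b + \<Delta> / 2))\<^sup>2 / 2 = (u - b + \<Delta> / 2)\<^sup>2 / 2"
      by (simp add: power2_eq_square field_simps)
    then show ?thesis using False by simp
  qed
  also have "\<dots> \<le> (max 0 (u - l))\<^sup>2 / 2"
    using lb \<open>b \<le> u\<close> \<open>\<Delta> > 0\<close> by (intro divide_right_mono power_mono) auto
  finally show ?case .
qed

text \<open>An equation \<open>a + d = b + c\<close> is read as \<open>a - b = c - d\<close>. Excluding the zero difference leaves
  only the trivial coincidence of equal ordered pairs.\<close>

lemma B2_sep_set_diff: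
  assumes "\<Delta> > 0" "B2_sep_set \<Delta> A"
    and "a \<in> A" "b \<in> A" "c \<in> A" "d \<in> A" and "a \<noteq> b" "c \<noteq> d" "(a, b) \<noteq> (c, d)"
  shows "\<bar>real_of_int (a - b) - real_of_int (c - d)\<bar> \<ge> \<Delta>"
proof -
  have "{a, d} \<noteq> {b, c}" using assms(7-) by (auto simp: doubleton_eq_iff)
  then have "\<bar>real_of_int ((a + d) - (b + c))\<bar> \<ge> \<Delta>"
    using assms(3-6) B2_sep_set_iff[OF assms(1), THEN iffD1, OF assms(2), rule_format, of a d b c]
    by simp
  then show ?thesis by (simp add: algebra_simps)
qed

lemma sum_pos_diff_le:
  fixes A :: "int set" and u :: int and \<Delta> :: real
  assumes "\<Delta> > 0" "B2_sep_set \<Delta> A" "finite A" "u \<ge> 0"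
  shows "(\<Sum>(a, b) | a \<in> A \<and> b \<in> A \<and> b < a \<and> a - b \<le> u. real_of_int (u - (a - b)))
           \<le> (real_of_int u)\<^sup>2 / (2 * \<Delta>)"
proof -
  define P where "P = {(a, b). a \<in> A \<and> b \<in> A \<and> b < a \<and> a - b \<le> u}"
  define f where "f = (\<lambda>(a, b). real_of_int (a - b))"
  have "finite P"
    by (rule finite_subset[of _ "A \<times> A"]) (use assms(3) in \<open>auto simp: P_def\<close>)
  have sep: "\<bar>f p - f q\<bar> \<ge> \<Delta>" if "p \<in> P" "q \<in> P" "p \<noteq> q" for p q
    using that B2_sep_set_diff[OF assms(1,2), of "fst p" "snd p" "fst q" "snd q"]
    by (auto simp: P_def f_def split_beta)
  have inj: "inj_on f P"
    using sep assms(1) by (force intro!: inj_onI)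
  have "separated \<Delta> (f ` P)"
    unfolding separated_def
  proof (intro ballI impI)
    fix x y assume "x \<in> f ` P" "y \<in> f ` P" "x < y"
    then show "y - x \<ge> \<Delta>" using sep by force
  qed
  moreover have "0 + \<Delta> / 2 \<le> d" if d: "d \<in> f ` P" for d
  proof -
    obtain a b where "(a, b) \<in> P" "d = f (a, b)" using d by auto
    then have "a \<in> A" "b \<in> A" "b < a" "d = real_of_int (a - b)"
      by (simp_all add: P_def f_def)
    \<comment> \<open>the differences of \<open>(a, b)\<close> and \<open>(b, a)\<close> are \<open>d\<close> and \<open>-d\<close>\<close>
    then show ?thesis using B2_sep_set_diff[OF assms(1,2), of a b b a] by simp
  qed
  moreover have "d \<le> real_of_int u" if "d \<in> f ` P" for d
    using that by (auto simp: P_def f_def simp flip: of_int_diff)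
  ultimately have "\<Delta> * (\<Sum>d\<in>f ` P. real_of_int u - d) \<le> (max 0 (real_of_int u - 0))\<^sup>2 / 2"
    using \<open>finite P\<close> assms(1) by (intro sum_separated_le) auto
  also have "(\<Sum>d\<in>f ` P. real_of_int u - d) = (\<Sum>(a, b)\<in>P. real_of_int (u - (a - b)))"
    by (subst sum.reindex[OF inj]) (auto simp: f_def intro!: sum.cong)
  finally show ?thesis
    using assms(1,4) by (simp add: P_def field_simps)
qed

section \<open>Counting in windows\<close>

lemma sum_of_bool_eq_card:
  fixes A :: "'a set"
  assumes "finite A"
  shows "(\<Sum>x\<in>A. of_bool (P x)) = real (card {x \<in> A. P x})"
  using assms by (subst sum_of_bool_eq) (auto simp: Int_def)

text \<open>The sum of the squares of the window counts, over all windows of length \<open>u\<close> that meet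
  \<open>{1..n}\<close>, counted as a sum over ordered pairs from \<open>A\<close>.\<close>

lemma sum_window_squares:
  fixes A :: "int set" and u :: int and n :: nat
  assumes "A \<subseteq> {1..int n}" "u \<ge> 1"
  shows "(\<Sum>m\<in>{2 - u..int n}. (real (card {a \<in> A. m \<le> a \<and> a < m + u}))\<^sup>2)
     = real (card A) * real_of_int u
       + 2 * (\<Sum>(a, b) | a \<in> A \<and> b \<in> A \<and> b < a \<and> a - b \<le> u. real_of_int (u - (a - b)))"
proof -
  define M where "M = {2 - u..int n}"
  define w :: "int \<Rightarrow> int \<Rightarrow> real" where "w m a = of_bool (m \<le> a \<and> a < m + u)" for m a
  \<comment> \<open>the number of windows that contain both \<open>a\<close> and \<open>b\<close>\<close>
  define g where "g = (\<lambda>(a, b). real_of_int (max 0 (u - \<bar>a - b\<bar>)))"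
  define P where "P = {(a, b). a \<in> A \<and> b \<in> A \<and> b < a}"
  have "finite A" using assms(1) finite_subset by blast
  then have "finite P"
    by (rule_tac finite_subset[of _ "A \<times> A"]) (auto simp: P_def)
  have card_eq: "real (card {a \<in> A. m \<le> a \<and> a < m + u}) = (\<Sum>a\<in>A. w m a)" for m
    using \<open>finite A\<close> by (simp only: w_def sum_of_bool_eq_card)
  have pair: "(\<Sum>m\<in>M. w m a * w m b) = g (a, b)" if "a \<in> A" "b \<in> A" for a b
  proof -
    have "a \<ge> 1" "b \<ge> 1" "a \<le> int n" "b \<le> int n" using that assms(1) by auto
    then have *: "{m \<in> M. m \<le> a \<and> a < m + u \<and> m \<le> b \<and> b < m + u} = {max a b - u + 1..min a b}"
      by (auto simp: M_def)
    have "(\<Sum>m\<in>M. w m a * w m b)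
        = (\<Sum>m\<in>M. of_bool (m \<le> a \<and> a < m + u \<and> m \<le> b \<and> b < m + u))"
      by (intro sum.cong) (auto simp: w_def)
    also have "\<dots> = real (card {m \<in> M. m \<le> a \<and> a < m + u \<and> m \<le> b \<and> b < m + u})"
      by (rule sum_of_bool_eq_card) (simp add: M_def)
    also have "\<dots> = g (a, b)"
      unfolding * by (auto simp: g_def max_def min_def)
    finally show ?thesis .
  qed
  have "(\<Sum>m\<in>M. (\<Sum>a\<in>A. w m a)\<^sup>2) = (\<Sum>m\<in>M. \<Sum>a\<in>A. \<Sum>b\<in>A. w m a * w m b)"
    by (simp add: power2_eq_square sum_product)
  also have "\<dots> = (\<Sum>a\<in>A. \<Sum>b\<in>A. \<Sum>m\<in>M. w m a * w m b)"
    by (subst sum.swap, rule sum.cong[OF refl], subst sum.swap, rule refl)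
  also have "\<dots> = (\<Sum>a\<in>A. \<Sum>b\<in>A. g (a, b))"
    by (intro sum.cong refl pair)
  also have "\<dots> = (\<Sum>p\<in>A \<times> A. g p)"
    by (simp add: sum.cartesian_product)
  also have "A \<times> A = ((\<lambda>a. (a, a)) ` A) \<union> (P \<union> prod.swap ` P)"
    by (auto simp: P_def image_iff)
  also have "(\<Sum>p\<in>\<dots>. g p) = (\<Sum>p\<in>(\<lambda>a. (a, a)) ` A. g p) + ((\<Sum>p\<in>P. g p) + (\<Sum>p\<in>prod.swap ` P. g p))"
    using \<open>finite A\<close> \<open>finite P\<close>
    by (subst sum.union_disjoint, auto simp: P_def, subst sum.union_disjoint, auto)
  also have "(\<Sum>p\<in>(\<lambda>a. (a, a)) ` A. g p) = real (card A) * real_of_int u"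
    using assms(2) by (subst sum.reindex) (auto simp: g_def inj_on_def)
  also have "(\<Sum>p\<in>prod.swap ` P. g p) = (\<Sum>p\<in>P. g p)"
    by (subst sum.reindex) (auto simp: g_def abs_minus_commute intro!: sum.cong)
  also have "(\<Sum>p\<in>P. g p) = (\<Sum>(a, b) | a \<in> A \<and> b \<in> A \<and> b < a \<and> a - b \<le> u. real_of_int (u - (a - b)))"
    using \<open>finite P\<close> by (intro sum.mono_neutral_cong_right) (auto simp: P_def g_def)
  finally show ?thesis
    by (simp add: card_eq M_def)
qed

lemma sum_window:
  fixes A :: "int set" and u :: int and n :: nat
  assumes "A \<subseteq> {1..int n}" "u \<ge> 1"
  shows "(\<Sum>m\<in>{2 - u..int n}. real (card {a \<in> A. m \<le> a \<and> a < m + u})) = real (card A) * real_of_int u"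
proof -
  have "finite A" using assms(1) finite_subset by blast
  then have "(\<Sum>m\<in>{2 - u..int n}. real (card {a \<in> A. m \<le> a \<and> a < m + u}))
      = (\<Sum>m\<in>{2 - u..int n}. \<Sum>a\<in>A. of_bool (m \<le> a \<and> a < m + u))"
    by (simp only: sum_of_bool_eq_card)
  also have "\<dots> = (\<Sum>a\<in>A. \<Sum>m\<in>{2 - u..int n}. of_bool (m \<le> a \<and> a < m + u))"
    by (rule sum.swap)
  also have "\<dots> = (\<Sum>a\<in>A. real_of_int u)"
  proof (rule sum.cong)
    fix a assume "a \<in> A"
    then have "{m \<in> {2 - u..int n}. m \<le> a \<and> a < m + u} = {a - u + 1..a}"
      using assms(1) by auto
    then have "card {m \<in> {2 - u..int n}. m \<le> a \<and> a < m + u} = nat u"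
      by simp
    then show "(\<Sum>m\<in>{2 - u..int n}. of_bool (m \<le> a \<and> a < m + u)) = real_of_int u"
      using assms(2) by (simp only: sum_of_bool_eq_card finite_atLeastAtMost_int)
  qed simp
  finally show ?thesis by simp
qed

lemma card_B2_sep_set_window:
  fixes A :: "int set" and u :: int and n :: nat and \<Delta> :: real
  assumes "\<Delta> > 0" "A \<subseteq> {1..int n}" "B2_sep_set \<Delta> A" "u \<ge> 1"
  shows "(real (card A))\<^sup>2
           \<le> (real n + real_of_int u) * (real (card A) / real_of_int u + 1 / \<Delta>)"
proof -
  define x where "x m = real (card {a \<in> A. m \<le> a \<and> a < m + u})" for m
  define k v where "k = real (card A)" and "v = real_of_int u"
  have "v > 0" using assms(4) by (simp add: v_def)
  have "finite A" using assms(2) finite_subset by blast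
  have "(k * v)\<^sup>2 = (\<Sum>m\<in>{2 - u..int n}. x m)\<^sup>2"
    using sum_window[OF assms(2,4)] by (simp add: x_def k_def v_def)
  also have "\<dots> \<le> (\<Sum>m\<in>{2 - u..int n}. (x m)\<^sup>2) * real (card {2 - u..int n})"
    using sum_squared_le_sum_of_squares[of x "{2 - u..int n}"] by (simp add: mult.commute)
  also have "\<dots> \<le> (k * v + v\<^sup>2 / \<Delta>) * (real n + v)"
  proof (intro mult_mono)
    show "(\<Sum>m\<in>{2 - u..int n}. (x m)\<^sup>2) \<le> k * v + v\<^sup>2 / \<Delta>"
      using sum_window_squares[OF assms(2,4)] assms(4)
        sum_pos_diff_le[OF assms(1,3) \<open>finite A\<close>, of u]
      by (simp add: x_def k_def v_def field_simps)
    show "real (card {2 - u..int n}) \<le> real n + v"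
      using assms(4) by (simp add: v_def)
    show "0 \<le> k * v + v\<^sup>2 / \<Delta>"
      using assms(1) \<open>v > 0\<close> by (simp add: k_def)
  qed auto
  also have "\<dots> = ((real n + v) * (k / v + 1 / \<Delta>)) * v\<^sup>2"
    using \<open>v > 0\<close> by (simp add: field_simps power2_eq_square)
  finally have "k\<^sup>2 * v\<^sup>2 \<le> ((real n + v) * (k / v + 1 / \<Delta>)) * v\<^sup>2"
    by (simp add: power_mult_distrib)
  then show ?thesis
    using \<open>v > 0\<close> by (simp add: k_def v_def)
qed

section \<open>The optimal window length\<close>

lemma quadratic_bound:
  fixes k s t :: real
  assumes "k\<^sup>2 \<le> s\<^sup>2 + k * t" "0 \<le> s" "0 \<le> t"
  shows "k \<le> s + t"
proof (rule ccontr)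
  assume "\<not> k \<le> s + t"
  then have "s * s < k * (k - t)"
    using assms(2,3) by (intro mult_strict_mono') auto
  then show False
    using assms(1) by (simp add: power2_eq_square algebra_simps)
qed

lemma sqrt_add_le:
  fixes x y :: real
  assumes "x > 0" "y \<ge> 0"
  shows "sqrt (x + y) \<le> sqrt x + y / (2 * sqrt x)"
proof (rule real_le_lsqrt)
  have "(sqrt x + y / (2 * sqrt x))\<^sup>2 = x + y + (y / (2 * sqrt x))\<^sup>2"
    using assms by (simp add: power2_sum)
  then show "x + y \<le> (sqrt x + y / (2 * sqrt x))\<^sup>2" by simp
qed (use assms in auto)

lemma card_B2_sep_set_le:
  fixes A :: "int set" and n :: nat and \<Delta> :: real
  assumes "\<Delta> \<ge> 1" "n \<ge> 1" "A \<subseteq> {1..int n}" "B2_sep_set \<Delta> A"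
  shows "real (card A) \<le> (real n / \<Delta>) powr (1/2) + 3 * real n powr (1/4)"
proof -
  define q where "q = real n powr (1/4)"
  define u where "u = \<lceil>real n powr (3/4)\<rceil>"
  define v where "v = real_of_int u"
  define k where "k = real (card A)"
  have "q \<ge> 1" using assms(2) by (simp add: q_def ge_one_powr_ge_zero)
  have q3: "real n powr (3/4) = q ^ 3" and q2: "sqrt (real n) = q\<^sup>2" and q4: "real n = q ^ 4"
    using assms(2) by (simp_all add: q_def powr_power flip: powr_half_sqrt)
  have "q ^ 3 \<ge> 1" using \<open>q \<ge> 1\<close> by simp
  then have "u \<ge> 1" unfolding u_def q3 by linarith
  have v: "q ^ 3 \<le> v" "v \<le> 2 * q ^ 3" "v > 0"
    using \<open>q ^ 3 \<ge> 1\<close> unfolding v_def u_def q3 by linarith+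
  define s where "s = sqrt ((real n + v) / \<Delta>)"
  define t where "t = (real n + v) / v"
  have "k\<^sup>2 \<le> (real n + v) * (k / v + 1 / \<Delta>)"
    using card_B2_sep_set_window[of \<Delta> A n u] assms \<open>u \<ge> 1\<close> by (simp add: k_def v_def)
  also have "\<dots> = s\<^sup>2 + k * t"
    using v assms(1) by (simp add: s_def t_def field_simps)
  finally have "k\<^sup>2 \<le> s\<^sup>2 + k * t" .
  moreover have "0 \<le> s" "0 \<le> t"
    using v(3) assms(1) by (simp_all add: s_def t_def)
  ultimately have "k \<le> s + t"
    by (rule quadratic_bound)
  moreover have "t \<le> 2 * q"
  proof -
    have "real n / v \<le> q ^ 4 / q ^ 3"
      unfolding q4 using v \<open>q \<ge> 1\<close> by (intro divide_left_mono) auto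
    also have "\<dots> = q" using \<open>q \<ge> 1\<close> by (simp add: eval_nat_numeral)
    finally show ?thesis using v \<open>q \<ge> 1\<close> by (simp add: t_def add_divide_distrib)
  qed
  moreover have "s \<le> sqrt (real n / \<Delta>) + q"
  proof -
    have "sqrt (real n + v) \<le> sqrt (real n) + v / (2 * sqrt (real n))"
      using assms(2) v(3) by (intro sqrt_add_le) auto
    moreover have "v / (2 * sqrt (real n)) \<le> (2 * q ^ 3) / (2 * q\<^sup>2)"
      unfolding q2 using v \<open>q \<ge> 1\<close> by (intro divide_right_mono) auto
    moreover have "(2 * q ^ 3) / (2 * q\<^sup>2) = q"
      using \<open>q \<ge> 1\<close> by (simp add: eval_nat_numeral)
    ultimately have "sqrt (real n + v) \<le> sqrt (real n) + q" by linarith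
    then have "s \<le> (sqrt (real n) + q) / sqrt \<Delta>"
      using assms(1) by (simp add: s_def real_sqrt_divide divide_right_mono)
    also have "\<dots> \<le> sqrt (real n / \<Delta>) + q / 1"
      unfolding add_divide_distrib real_sqrt_divide
      using assms(1) \<open>q \<ge> 1\<close> by (intro add_left_mono divide_left_mono) auto
    finally show ?thesis by simp
  qed
  ultimately have "k \<le> sqrt (real n / \<Delta>) + 3 * q" by simp
  then show ?thesis
    using assms(1) by (simp add: k_def q_def powr_half_sqrt)
qed

lemma F2_sep_le:
  assumes "\<Delta> \<ge> 1" "n \<ge> 1"
  shows "real (F2_sep \<Delta> n) \<le> (real n / \<Delta>) powr (1/2) + 3 * real n powr (1/4)"
proof -
  have "F2_sep \<Delta> n \<in> card ` {A. A \<subseteq> {1..int n} \<and> B2_sep_set \<Delta> A}"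
    unfolding F2_sep_def using finite_B2_sep_sets[of n \<Delta>] B2_sep_set_empty[of \<Delta>]
    by (intro Max_in) auto
  then show ?thesis
    using card_B2_sep_set_le[OF assms] by auto
qed

theorem theorem3:
  fixes \<Delta> :: nat
  assumes "\<Delta> > 0"
  shows "(\<exists>g \<in> O(\<lambda>n. real n powr (1/4)). \<forall>\<^sub>F n in sequentially.
            real (F2_sep (real \<Delta>) n) \<le> (real n / real \<Delta>) powr (1/2) + g n) \<and>
         limsup (\<lambda>n. ereal (real (F2_sep (real \<Delta>) n) / (real n / real \<Delta>) powr (1/2))) \<le> 1"
proof
  have \<Delta>: "real \<Delta> \<ge> 1" using assms by simp
  have "\<forall>\<^sub>F n in sequentially. real (F2_sep (real \<Delta>) n)
      \<le> (real n / real \<Delta>) powr (1/2) + 3 * real n powr (1/4)"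
    using eventually_ge_at_top[of 1] by eventually_elim (rule F2_sep_le[OF \<Delta>])
  then show "\<exists>g \<in> O(\<lambda>n. real n powr (1/4)). \<forall>\<^sub>F n in sequentially.
      real (F2_sep (real \<Delta>) n) \<le> (real n / real \<Delta>) powr (1/2) + g n"
    by (intro bexI[of _ "\<lambda>n. 3 * real n powr (1/4)"]) auto
  define h where "h n = 1 + 3 * real n powr (1/4) / (real n / real \<Delta>) powr (1/2)" for n :: nat
  have "\<forall>\<^sub>F n in sequentially.
      ereal (real (F2_sep (real \<Delta>) n) / (real n / real \<Delta>) powr (1/2)) \<le> ereal (h n)"
    using eventually_ge_at_top[of 1]
  proof eventually_elim
    case (elim n)
    then have "(real n / real \<Delta>) powr (1/2) > 0" using assms by simp
    then show ?case using F2_sep_le[OF \<Delta> elim] by (simp add: h_def field_simps)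
  qed
  then have "limsup (\<lambda>n. ereal (real (F2_sep (real \<Delta>) n) / (real n / real \<Delta>) powr (1/2)))
      \<le> limsup (\<lambda>n. ereal (h n))"
    by (rule Limsup_mono)
  also have "h \<longlonglongrightarrow> 1"
    unfolding h_def using assms by real_asymp
  then have "limsup (\<lambda>n. ereal (h n)) = 1"
    by (intro lim_imp_Limsup) (simp_all add: one_ereal_def)
  finally show "limsup (\<lambda>n. ereal (real (F2_sep (real \<Delta>) n) / (real n / real \<Delta>) powr (1/2))) \<le> 1" .
qed

end
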